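(* Let $\varphi(z)=\frac{az+b}{cz+d}$ be a linear fractional self-map of $\mathbb{D}$ with $\|\varphi\|_\infty=\sup_{z\in\mathbb{D}}|\varphi(z)|<1$, and let $\sigma(z)=\frac{\overline{a}z-\overline{c}}{-\overline{b}z+\overline{d}}$ be its Krein adjoint. Consider $D_\varphi$ acting on $\widetilde{S}^2$. Then there is a finite rank operator $K_1$ on $\widetilde{S}^2$ such that $$D_\varphi^*\,T_z^*=T_z\,D_\sigma+K_1,$$ where adjoints are taken with respect to the inner product of $\widetilde{S}^2$ and $T_z$ denotes multiplication by the function $z$.
   Context: $\mathbb{D}$ is the open unit disk. $\widetilde{S}^2$ is the Hilbert space of analytic $f(z)=\sum_{n\ge0}a_nz^n$ on $\mathbb{D}$ with inner product $\langle f,g\rangle=a_0\overline{b_0}+a_1\overline{b_1}+\sum_{n\ge2}n(n-1)a_n\overline{b_n}$ for $g(z)=\sum b_nz^n$ (a weighted Hardy space with weights $\beta(0)=\beta(1)=1$, $\beta(n)=\sqrt{n(n-1)}$ for $n\ge2$; it has the same elements as $S^2$ with an equivalent norm). Its reproducing kernel is $K_w(z)=1+2\overline{w}z+(1-\overline{w}z)\log(1-\overline{w}z)$, and the kernel for evaluation of the derivative at $w$ is $K^{(1)}_w(z)=z-z\log(1-\overline{w}z)$. $D_\varphi f=f'\circ\varphi$; $T_\psi f=\psi f$ denotes multiplication by $\psi$. *)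

theory Defs
  imports "HOL-Analysis.Analysis"
begin

text \<open>Functions analytic on the unit disk are represented as functions complex \<Rightarrow> complex;
  only their values on the open unit disk matter. The n-th Taylor coefficient at 0:\<close>
definition tcoeff :: "(complex \<Rightarrow> complex) \<Rightarrow> nat \<Rightarrow> complex" where
  "tcoeff f n = (deriv ^^ n) f 0 / of_nat (fact n)"

definition wt2 :: "nat \<Rightarrow> real" where
  "wt2 n = (if n \<le> 1 then 1 else real n * (real n - 1))"

definition St2 :: "(complex \<Rightarrow> complex) set" where
  "St2 = {f. f holomorphic_on ball 0 1 \<and> summable (\<lambda>n. wt2 n * (cmod (tcoeff f n))\<^sup>2)}"

definition St2_inner :: "(complex \<Rightarrow> complex) \<Rightarrow> (complex \<Rightarrow> complex) \<Rightarrow> complex" where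
  "St2_inner f g = (\<Sum>n. of_real (wt2 n) * tcoeff f n * cnj (tcoeff g n))"

definition St2_norm :: "(complex \<Rightarrow> complex) \<Rightarrow> real" where
  "St2_norm f = sqrt (\<Sum>n. wt2 n * (cmod (tcoeff f n))\<^sup>2)"

text \<open>Equality of elements of S~^2 (= equality on the disk).\<close>
definition disk_eq :: "(complex \<Rightarrow> complex) \<Rightarrow> (complex \<Rightarrow> complex) \<Rightarrow> bool" where
  "disk_eq f g \<longleftrightarrow> (\<forall>z\<in>ball 0 1. f z = g z)"

definition Dop :: "(complex \<Rightarrow> complex) \<Rightarrow> (complex \<Rightarrow> complex) \<Rightarrow> (complex \<Rightarrow> complex)" where
  "Dop \<phi> f = (\<lambda>z. deriv f (\<phi> z))"

definition Tz :: "(complex \<Rightarrow> complex) \<Rightarrow> (complex \<Rightarrow> complex)" where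
  "Tz f = (\<lambda>z. z * f z)"

definition is_adjoint :: "((complex \<Rightarrow> complex) \<Rightarrow> (complex \<Rightarrow> complex))
     \<Rightarrow> ((complex \<Rightarrow> complex) \<Rightarrow> (complex \<Rightarrow> complex)) \<Rightarrow> bool" where
  "is_adjoint A B \<longleftrightarrow> (\<forall>g\<in>St2. B g \<in> St2) \<and>
     (\<forall>f\<in>St2. \<forall>g\<in>St2. St2_inner (A f) g = St2_inner f (B g))"

definition finite_rank_op :: "((complex \<Rightarrow> complex) \<Rightarrow> (complex \<Rightarrow> complex)) \<Rightarrow> bool" where
  "finite_rank_op K \<longleftrightarrow>
     (\<forall>f\<in>St2. K f \<in> St2) \<and>
     (\<forall>f\<in>St2. \<forall>g\<in>St2. \<forall>c::complex.
        disk_eq (K (\<lambda>z. c * f z + g z)) (\<lambda>z. c * K f z + K g z)) \<and>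
     (\<exists>C. \<forall>f\<in>St2. St2_norm (K f) \<le> C * St2_norm f) \<and>
     (\<exists>F. finite F \<and> F \<subseteq> St2 \<and>
        (\<forall>f\<in>St2. \<exists>c. disk_eq (K f) (\<lambda>z. \<Sum>h\<in>F. c h * h z)))"

end

theory Submission
  imports Defs "HOL-Complex_Analysis.Complex_Analysis"
begin

text \<open>
  Bounded operators on \<open>S~\<^sup>2\<close> have adjoints, and the value of \<open>D\<^sub>\<phi>\<^sup>* T\<^sub>z\<^sup>* f\<close> at \<open>\<zeta>\<close> is
  the inner product of \<open>f\<close> with \<open>T\<^sub>z D\<^sub>\<phi> K\<^sub>\<zeta>\<close>. Put \<open>L\<^sub>s(z) = 1 - Ln (1 - cnj s z)\<close>. Then
  \<open>K\<^sub>\<zeta>' = cnj \<zeta> L\<^sub>\<zeta>\<close>, while the kernel for the derivative at \<open>s\<close> is \<open>z L\<^sub>s(z)\<close>. The Krein adjoint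
  satisfies \<open>(1 - cnj \<zeta> \<phi>(w)) (1 - cnj (\<sigma>(0)) w) = (1 - cnj (\<sigma>(\<zeta>)) w) (1 - cnj \<zeta> \<phi>(0))\<close>, and all
  four factors lie in the right half plane, so
  \<open>L\<^sub>\<zeta>(\<phi>(w)) = L\<^bsub>\<sigma>(\<zeta>)\<^esub>(w) - L\<^bsub>\<sigma>(0)\<^esub>(w) + L\<^sub>\<zeta>(\<phi>(0))\<close>.
  Multiplying by \<open>cnj \<zeta> w\<close> and pairing with \<open>f\<close> gives
  \<open>\<zeta> f'(\<sigma>(\<zeta>)) - \<zeta> f'(\<sigma>(0)) + f'(0) \<zeta> L\<^bsub>\<phi>(0)\<^esub>(\<zeta>)\<close>, and the last two terms have rank at most 2.
\<close>

section \<open>Taylor coefficients\<close>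

lemma sums_tcoeff:
  assumes "f holomorphic_on ball 0 r" "cmod z < r"
  shows "(\<lambda>n. tcoeff f n * z ^ n) sums f z"
  using holomorphic_power_series[OF assms(1), of z] assms(2) by (simp add: tcoeff_def)

lemma eventually_nhds_0_if_unit_disk:
  fixes P :: "complex \<Rightarrow> bool"
  assumes "\<And>z. cmod z < 1 \<Longrightarrow> P z"
  shows "eventually P (nhds 0)"
  unfolding eventually_nhds using assms by (intro exI[of _ "ball 0 1"]) auto

lemma tcoeff_eqI:
  assumes "\<And>z. cmod z < 1 \<Longrightarrow> (\<lambda>n. a n * z ^ n) sums f z"
  shows "tcoeff f = a"
proof -
  have "eventually (\<lambda>z. (\<lambda>n. fps_nth (Abs_fps a) n * z ^ n) sums f z) (nhds 0)"
    using assms by (intro eventually_nhds_0_if_unit_disk) simp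
  from fps_nth_fps_expansion[OF has_fps_expansionI[OF this]] show ?thesis
    by (auto simp: tcoeff_def fun_eq_iff)
qed

lemma tcoeff_eq_if_disk_eq:
  assumes "disk_eq f g"
  shows "tcoeff f = tcoeff g"
proof
  have "eventually (\<lambda>z. f z = g z) (nhds 0)"
    using assms by (intro eventually_nhds_0_if_unit_disk) (simp add: disk_eq_def)
  then show "tcoeff f n = tcoeff g n" for n
    unfolding tcoeff_def by (metis higher_deriv_cong_ev)
qed

lemma tcoeff_linear:
  assumes "f holomorphic_on ball 0 1" "g holomorphic_on ball 0 1"
  shows "tcoeff (\<lambda>z. c * f z + g z) = (\<lambda>n. c * tcoeff f n + tcoeff g n)"
proof (rule tcoeff_eqI)
  fix z :: complex assume z: "cmod z < 1"
  show "(\<lambda>n. (c * tcoeff f n + tcoeff g n) * z ^ n) sums (c * f z + g z)"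
    using sums_add[OF sums_mult[OF sums_tcoeff[OF assms(1) z], of c] sums_tcoeff[OF assms(2) z]]
    by (simp add: algebra_simps)
qed

lemma tcoeff_cmult:
  assumes "f holomorphic_on ball 0 1"
  shows "tcoeff (\<lambda>z. c * f z) = (\<lambda>n. c * tcoeff f n)"
proof (rule tcoeff_eqI)
  show "(\<lambda>n. c * tcoeff f n * z ^ n) sums (c * f z)" if "cmod z < 1" for z
    using sums_mult[OF sums_tcoeff[OF assms that], of c] by (simp add: mult.assoc)
qed

lemma tcoeff_deriv: "tcoeff (deriv f) n = of_nat (Suc n) * tcoeff f (Suc n)"
  by (simp add: tcoeff_def funpow_Suc_right del: funpow.simps of_nat_Suc fact_Suc)
     (simp add: field_simps del: of_nat_Suc)

lemma tcoeff_Tz: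
  assumes "f holomorphic_on ball 0 1"
  shows "tcoeff (Tz f) = case_nat 0 (tcoeff f)"
proof (rule tcoeff_eqI)
  fix z :: complex assume z: "cmod z < 1"
  have "(\<lambda>n. case_nat 0 (tcoeff f) (Suc n) * z ^ Suc n) sums (z * f z)"
    using sums_mult[OF sums_tcoeff[OF assms z], of z] by (simp add: ac_simps)
  from sums_Suc[OF this] show "(\<lambda>n. case_nat 0 (tcoeff f) n * z ^ n) sums Tz f z"
    by (simp add: Tz_def)
qed

lemma tcoeff_polynomial:
  "tcoeff (\<lambda>z. \<Sum>n<N. a n * z ^ n) = (\<lambda>n. if n < N then a n else 0)"
proof (rule tcoeff_eqI)
  show "(\<lambda>n. (if n < N then a n else 0) * z ^ n) sums (\<Sum>n<N. a n * z ^ n)" for z :: complex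
    using sums_If_finite_set[of "{..<N}" "\<lambda>n. a n * z ^ n"]
    by (simp add: if_distrib[of "\<lambda>x. x * _"] cong: if_cong)
qed

lemma cmod_tcoeff_le_Cauchy:
  assumes "f holomorphic_on cball 0 R" "0 < R" "\<And>z. cmod z \<le> R \<Longrightarrow> cmod (f z) \<le> B"
  shows "cmod (tcoeff f n) \<le> B * (1 / R) ^ n"
proof -
  have "cmod ((deriv ^^ n) f 0) \<le> fact n * B / R ^ n"
    by (rule Cauchy_inequality)
       (use assms in \<open>auto intro: holomorphic_on_subset holomorphic_on_imp_continuous_on\<close>)
  then show ?thesis
    by (simp add: tcoeff_def norm_divide field_simps)
qed


section \<open>The Hilbert space structure\<close>

lemma wt2_ge_1: "1 \<le> wt2 n"
proof (cases "n \<le> 1")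
  case False
  then have "1 * 1 \<le> real n * (real n - 1)"
    by (intro mult_mono) auto
  with False show ?thesis by (simp add: wt2_def)
qed (simp add: wt2_def)

lemma wt2_pos [simp]: "0 < wt2 n"
  using wt2_ge_1[of n] by simp

lemma wt2_neq_0 [simp]: "wt2 n \<noteq> 0"
  using wt2_pos[of n] by linarith

lemma wt2_nonneg [simp]: "0 \<le> wt2 n"
  by (rule wt2_pos[THEN less_imp_le])

lemma wt2_le_Suc_square: "wt2 n \<le> (real (Suc n))\<^sup>2"
  by (simp add: wt2_def power2_eq_square algebra_simps)

lemma wt2_Suc_le: "wt2 (Suc n) \<le> 4 * wt2 n"
proof (cases "n \<le> 1")
  case False
  then have "real n * (real n + 1) \<le> real n * (4 * (real n - 1))"
    by (intro mult_left_mono) auto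
  with False show ?thesis
    by (simp add: wt2_def algebra_simps)
qed (auto simp: wt2_def le_Suc_eq)

definition weighted_modulus :: "(nat \<Rightarrow> complex) \<Rightarrow> nat \<Rightarrow> real" where
  "weighted_modulus a n = sqrt (wt2 n) * cmod (a n)"

lemma weighted_modulus_nonneg [simp]: "0 \<le> weighted_modulus a n"
  by (simp add: weighted_modulus_def)

lemma cmod_le_weighted_modulus: "cmod (a n) \<le> weighted_modulus a n"
  using mult_right_mono[of 1 "sqrt (wt2 n)" "cmod (a n)"] wt2_ge_1[of n]
  by (simp add: weighted_modulus_def)

lemma L2_set_weighted_modulus:
  "L2_set (weighted_modulus a) A = sqrt (\<Sum>n\<in>A. wt2 n * (cmod (a n))\<^sup>2)"
  by (simp add: L2_set_def weighted_modulus_def power_mult_distrib)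

lemma St2_holomorphic: "f \<in> St2 \<Longrightarrow> f holomorphic_on ball 0 1"
  by (simp add: St2_def)

lemma St2_deriv_holomorphic: "f \<in> St2 \<Longrightarrow> deriv f holomorphic_on ball 0 1"
  by (intro holomorphic_deriv St2_holomorphic) auto

lemma L2_set_le_St2_norm:
  assumes "f \<in> St2"
  shows "L2_set (weighted_modulus (tcoeff f)) {..<N} \<le> St2_norm f"
  using assms unfolding L2_set_weighted_modulus St2_norm_def
  by (intro real_sqrt_le_mono sum_le_suminf) (auto simp: St2_def)

lemma St2I_L2_set:
  assumes "f holomorphic_on ball 0 1"
    and bound: "\<And>N. L2_set (weighted_modulus (tcoeff f)) {..<N} \<le> B"
  shows "f \<in> St2" and "St2_norm f \<le> B"
proof -
  have "0 \<le> B"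
    using bound[of 0] by simp
  have sum_le: "(\<Sum>n<N. wt2 n * (cmod (tcoeff f n))\<^sup>2) \<le> B\<^sup>2" for N
    using bound[of N] unfolding L2_set_weighted_modulus by (rule sqrt_le_D)
  then have summable: "summable (\<lambda>n. wt2 n * (cmod (tcoeff f n))\<^sup>2)"
    by (intro summableI_nonneg_bounded) auto
  with assms(1) show "f \<in> St2"
    by (simp add: St2_def)
  show "St2_norm f \<le> B"
    unfolding St2_norm_def using \<open>0 \<le> B\<close> suminf_le_const[OF summable sum_le]
    by (rule real_le_lsqrt)
qed

lemma St2_norm_nonneg: "f \<in> St2 \<Longrightarrow> 0 \<le> St2_norm f"
  using L2_set_le_St2_norm[of f 0] by simp

lemma St2_linear_combination:
  assumes "f \<in> St2" "g \<in> St2"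
  shows "(\<lambda>z. c * f z + g z) \<in> St2"
    and "St2_norm (\<lambda>z. c * f z + g z) \<le> cmod c * St2_norm f + St2_norm g"
proof -
  let ?h = "\<lambda>z. c * f z + g z"
  note hol = assms[THEN St2_holomorphic]
  have "L2_set (weighted_modulus (tcoeff ?h)) {..<N} \<le> cmod c * St2_norm f + St2_norm g" for N
  proof -
    let ?f = "weighted_modulus (tcoeff f)" and ?g = "weighted_modulus (tcoeff g)"
    have "weighted_modulus (tcoeff ?h) n \<le> cmod c * ?f n + ?g n" for n
      using mult_left_mono[OF norm_triangle_ineq[of "c * tcoeff f n" "tcoeff g n"], of "sqrt (wt2 n)"]
      by (simp only: weighted_modulus_def tcoeff_linear[OF hol] norm_mult distrib_left
          mult.left_commute real_sqrt_ge_zero wt2_nonneg)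
    then have "L2_set (weighted_modulus (tcoeff ?h)) {..<N}
        \<le> L2_set (\<lambda>n. cmod c * ?f n + ?g n) {..<N}"
      by (intro L2_set_mono) auto
    also have "\<dots> \<le> cmod c * L2_set ?f {..<N} + L2_set ?g {..<N}"
      by (simp add: L2_set_right_distrib L2_set_triangle_ineq)
    also have "\<dots> \<le> cmod c * St2_norm f + St2_norm g"
      by (intro add_mono mult_left_mono L2_set_le_St2_norm assms) auto
    finally show ?thesis .
  qed
  moreover have "?h holomorphic_on ball 0 1"
    using hol by (intro holomorphic_intros)
  ultimately show "?h \<in> St2" "St2_norm ?h \<le> cmod c * St2_norm f + St2_norm g"
    using St2I_L2_set by blast+
qed

lemma St2_Cauchy_Schwarz:
  assumes "f \<in> St2" "g \<in> St2"
  shows "summable (\<lambda>n. cmod (of_real (wt2 n) * tcoeff f n * cnj (tcoeff g n)))"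
    and "cmod (St2_inner f g) \<le> St2_norm f * St2_norm g"
proof -
  let ?t = "\<lambda>n. of_real (wt2 n) * tcoeff f n * cnj (tcoeff g n)"
  have sum_le: "(\<Sum>n<N. cmod (?t n)) \<le> St2_norm f * St2_norm g" for N
  proof -
    have "(\<Sum>n<N. cmod (?t n))
        = (\<Sum>n<N. \<bar>weighted_modulus (tcoeff f) n\<bar> * \<bar>weighted_modulus (tcoeff g) n\<bar>)"
    proof (intro sum.cong refl)
      fix n
      have "cmod (?t n) = (sqrt (wt2 n) * sqrt (wt2 n)) * (cmod (tcoeff f n) * cmod (tcoeff g n))"
        by (simp add: norm_mult)
      also have "\<dots> = \<bar>weighted_modulus (tcoeff f) n\<bar> * \<bar>weighted_modulus (tcoeff g) n\<bar>"
        by (simp only: weighted_modulus_nonneg abs_of_nonneg) (simp only: weighted_modulus_def ac_simps)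
      finally show "cmod (?t n) = \<bar>weighted_modulus (tcoeff f) n\<bar> * \<bar>weighted_modulus (tcoeff g) n\<bar>" .
    qed
    also have "\<dots> \<le> L2_set (weighted_modulus (tcoeff f)) {..<N}
        * L2_set (weighted_modulus (tcoeff g)) {..<N}"
      by (rule L2_set_mult_ineq)
    also have "\<dots> \<le> St2_norm f * St2_norm g"
      using assms by (intro mult_mono L2_set_le_St2_norm St2_norm_nonneg) auto
    finally show ?thesis .
  qed
  then show summable: "summable (\<lambda>n. cmod (?t n))"
    by (intro summableI_nonneg_bounded) auto
  show "cmod (St2_inner f g) \<le> St2_norm f * St2_norm g"
    unfolding St2_inner_def
    by (rule order_trans[OF summable_norm[OF summable] suminf_le_const[OF summable sum_le]])
qed

lemma St2_inner_sums:
  assumes "f \<in> St2" "g \<in> St2"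
  shows "(\<lambda>n. of_real (wt2 n) * tcoeff f n * cnj (tcoeff g n)) sums St2_inner f g"
  unfolding St2_inner_def
  by (rule summable_sums[OF summable_norm_cancel[OF St2_Cauchy_Schwarz(1)[OF assms]]])

lemma St2_inner_commute:
  assumes "f \<in> St2" "g \<in> St2"
  shows "St2_inner g f = cnj (St2_inner f g)"
proof (rule sums_unique2)
  show "(\<lambda>n. of_real (wt2 n) * tcoeff g n * cnj (tcoeff f n)) sums St2_inner g f"
    using assms by (intro St2_inner_sums)
  show "(\<lambda>n. of_real (wt2 n) * tcoeff g n * cnj (tcoeff f n)) sums cnj (St2_inner f g)"
    using sums_cnj[THEN iffD2, OF St2_inner_sums[OF assms]] by (simp add: ac_simps)
qed

lemma St2_inner_linear_left:
  assumes "f \<in> St2" "g \<in> St2" "h \<in> St2"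
  shows "St2_inner (\<lambda>z. c * f z + g z) h = c * St2_inner f h + St2_inner g h"
proof (rule sums_unique2)
  let ?l = "\<lambda>z. c * f z + g z"
  show "(\<lambda>n. of_real (wt2 n) * tcoeff ?l n * cnj (tcoeff h n)) sums St2_inner ?l h"
    using assms by (intro St2_inner_sums St2_linear_combination)
  show "(\<lambda>n. of_real (wt2 n) * tcoeff ?l n * cnj (tcoeff h n))
      sums (c * St2_inner f h + St2_inner g h)"
    using sums_add[OF sums_mult[OF St2_inner_sums[OF assms(1,3)], of c] St2_inner_sums[OF assms(2,3)]]
    unfolding tcoeff_linear[OF assms(1,2)[THEN St2_holomorphic]] by (simp add: algebra_simps)
qed

lemma St2_inner_linear_right:
  assumes "f \<in> St2" "g \<in> St2" "h \<in> St2"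
  shows "St2_inner h (\<lambda>z. c * f z + g z) = cnj c * St2_inner h f + St2_inner h g"
  using assms by (simp add: St2_inner_commute[of _ h] St2_linear_combination St2_inner_linear_left)

lemma St2_inner_cmult_right:
  assumes "f \<in> St2" "g \<in> St2"
  shows "St2_inner f (\<lambda>z. c * g z) = cnj c * St2_inner f g"
proof -
  have "(\<lambda>n. of_real (wt2 n) * tcoeff f n * cnj (tcoeff (\<lambda>z. c * g z) n)) sums (cnj c * St2_inner f g)"
    using sums_mult[OF St2_inner_sums[OF assms], of "cnj c"]
    unfolding tcoeff_cmult[OF St2_holomorphic[OF assms(2)]] by (simp add: ac_simps)
  then show ?thesis
    by (simp add: St2_inner_def sums_iff)
qed

lemma polynomial_holomorphic: "(\<lambda>z. \<Sum>n<N. a n * z ^ n) holomorphic_on A" for a :: "nat \<Rightarrow> complex"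
  by (intro holomorphic_intros)

lemma polynomial_in_St2: "(\<lambda>z. \<Sum>n<N. a n * z ^ n) \<in> St2"
proof -
  have "summable (\<lambda>n. wt2 n * (cmod (if n < N then a n else 0))\<^sup>2)"
    by (rule summable_finite[of "{..<N}"]) auto
  then show ?thesis
    by (simp add: St2_def tcoeff_polynomial polynomial_holomorphic)
qed

lemma St2_norm_polynomial:
  "St2_norm (\<lambda>z. \<Sum>n<N. a n * z ^ n) = L2_set (weighted_modulus a) {..<N}"
proof -
  have "(\<lambda>n. wt2 n * (cmod (if n < N then a n else 0))\<^sup>2) sums (\<Sum>n<N. wt2 n * (cmod (a n))\<^sup>2)"
    using sums_finite[of "{..<N}" "\<lambda>n. wt2 n * (cmod (if n < N then a n else 0))\<^sup>2"] by simp
  then show ?thesis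
    by (simp add: St2_norm_def L2_set_weighted_modulus tcoeff_polynomial sums_iff)
qed

lemma zero_in_St2: "(\<lambda>_. 0) \<in> St2"
  using polynomial_in_St2[where N = 0] by simp

lemma St2_cmult:
  assumes "f \<in> St2"
  shows "(\<lambda>z. c * f z) \<in> St2" and "St2_norm (\<lambda>z. c * f z) \<le> cmod c * St2_norm f"
  using St2_linear_combination[OF assms zero_in_St2, of c] St2_norm_polynomial[where N = 0]
  by simp_all

lemma power_in_St2: "(\<lambda>z. z ^ n) \<in> St2"
  using polynomial_in_St2[where N = "Suc n" and a = "\<lambda>k. if k = n then 1 else 0"]
  by (simp add: if_distrib[of "\<lambda>x. x * _"] cong: if_cong)

lemma St2_taylor_remainder_tendsto_0:
  assumes "f \<in> St2"
  shows "(\<lambda>N. St2_norm (\<lambda>z. f z - (\<Sum>n<N. tcoeff f n * z ^ n))) \<longlonglongrightarrow> 0"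
proof -
  let ?x = "\<lambda>n. wt2 n * (cmod (tcoeff f n))\<^sup>2"
  have summable: "summable ?x"
    using assms by (simp add: St2_def)
  have "St2_norm (\<lambda>z. f z - (\<Sum>n<N. tcoeff f n * z ^ n)) = sqrt (suminf ?x - sum ?x {..<N})" for N
  proof -
    have tcoeff_remainder: "tcoeff (\<lambda>z. f z - (\<Sum>n<N. tcoeff f n * z ^ n))
        = (\<lambda>n. if n < N then 0 else tcoeff f n)"
      using tcoeff_linear[OF polynomial_holomorphic St2_holomorphic[OF assms], of "- 1" "tcoeff f" N]
      by (auto simp: tcoeff_polynomial)
    have "(\<lambda>n. ?x n - (if n \<in> {..<N} then ?x n else 0)) sums (suminf ?x - sum ?x {..<N})"
      by (intro sums_diff summable_sums summable sums_If_finite_set) auto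
    also have "(\<lambda>n. ?x n - (if n \<in> {..<N} then ?x n else 0))
        = (\<lambda>n. wt2 n * (cmod (if n < N then 0 else tcoeff f n))\<^sup>2)"
      by auto
    finally show ?thesis
      unfolding St2_norm_def tcoeff_remainder by (simp add: sums_iff)
  qed
  moreover have "(\<lambda>N. sqrt (suminf ?x - sum ?x {..<N})) \<longlonglongrightarrow> sqrt (suminf ?x - suminf ?x)"
    by (intro tendsto_intros summable_LIMSEQ summable)
  ultimately show ?thesis by simp
qed

lemma St2_power_series:
  assumes bound: "\<And>N. L2_set (weighted_modulus a) {..<N} \<le> B"
  obtains f where "f \<in> St2" "tcoeff f = a"
proof -
  let ?f = "\<lambda>z. \<Sum>n. a n * z ^ n"
  have coeff_bound: "cmod (a n) \<le> B" for n
    using cmod_le_weighted_modulus[of a n] member_le_L2_set[of "{..<Suc n}" n "weighted_modulus a"]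
      bound[of "Suc n"] by simp
  have sums: "(\<lambda>n. a n * z ^ n) sums ?f z" if "cmod z < 1" for z
  proof (rule summable_sums, rule summable_comparison_test')
    show "summable (\<lambda>n. B * cmod z ^ n)"
      using that by (intro summable_mult) auto
    show "norm (a n * z ^ n) \<le> B * cmod z ^ n" for n
      using coeff_bound by (simp add: norm_mult norm_power mult_right_mono)
  qed
  show thesis
  proof
    show coeff: "tcoeff ?f = a"
      by (rule tcoeff_eqI[OF sums])
    show "?f \<in> St2"
    proof (rule St2I_L2_set(1))
      show "?f holomorphic_on ball 0 1"
        using sums by (intro power_series_holomorphic[where a = a]) auto
    qed (use bound coeff in simp)
  qed
qed

lemma St2_holomorphic_cball:
  assumes hol: "f holomorphic_on cball 0 R" and R: "1 < R"
    and bound: "\<And>z. cmod z \<le> R \<Longrightarrow> cmod (f z) \<le> B"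
  shows "f \<in> St2" and "St2_norm f \<le> B / (1 - 1 / R)\<^sup>2"
proof -
  have B_nonneg: "0 \<le> B"
    using order_trans[OF norm_ge_zero bound[of 0]] R by simp
  have geometric: "(\<lambda>n. real (Suc n) * (1 / R) ^ n) sums (1 / (1 - 1 / R)\<^sup>2)"
    using R by (intro geometric_deriv_sums) auto
  have "L2_set (weighted_modulus (tcoeff f)) {..<N} \<le> B / (1 - 1 / R)\<^sup>2" for N
  proof -
    have "weighted_modulus (tcoeff f) n \<le> B * (real (Suc n) * (1 / R) ^ n)" for n
    proof -
      have "sqrt (wt2 n) \<le> real (Suc n)"
        by (intro real_le_lsqrt wt2_le_Suc_square) auto
      then have "weighted_modulus (tcoeff f) n \<le> real (Suc n) * (B * (1 / R) ^ n)"
        unfolding weighted_modulus_def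
        using assms by (intro mult_mono cmod_tcoeff_le_Cauchy) auto
      then show ?thesis
        by (simp only: mult.left_commute)
    qed
    then have "L2_set (weighted_modulus (tcoeff f)) {..<N}
        \<le> (\<Sum>n<N. B * (real (Suc n) * (1 / R) ^ n))"
      by (intro order_trans[OF L2_set_le_sum] sum_mono) auto
    also have "\<dots> \<le> B * (1 / (1 - 1 / R)\<^sup>2)"
      unfolding sum_distrib_left[symmetric] sums_unique[OF geometric] using B_nonneg R geometric
      by (intro mult_left_mono sum_le_suminf) (auto simp: sums_iff)
    finally show ?thesis by simp
  qed
  moreover have "f holomorphic_on ball 0 1"
    using hol by (rule holomorphic_on_subset) (use R in auto)
  ultimately show "f \<in> St2" "St2_norm f \<le> B / (1 - 1 / R)\<^sup>2"
    using St2I_L2_set by blast+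
qed

lemma cball_subset_open_imp_larger_cball_subset:
  fixes a :: "'a :: {real_normed_vector, heine_borel}"
  assumes "open U" "cball a r \<subseteq> U" "0 \<le> r"
  obtains R where "r < R" "cball a R \<subseteq> U"
proof -
  obtain \<epsilon> where \<epsilon>: "0 < \<epsilon>" "(\<Union>x\<in>cball a r. cball x \<epsilon>) \<subseteq> U"
    using compact_subset_open_imp_cball_epsilon_subset[OF compact_cball assms(1,2)] by blast
  have "z \<in> U" if "z \<in> cball a (r + \<epsilon>)" for z
  proof -
    define t where "t = r / (r + \<epsilon>)"
    define x where "x = a + t *\<^sub>R (z - a)"
    have t: "0 \<le> t" "t \<le> 1" "t * (r + \<epsilon>) = r" "(1 - t) * (r + \<epsilon>) = \<epsilon>"
      using \<epsilon>(1) \<open>0 \<le> r\<close> by (auto simp: t_def field_simps)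
    have z: "norm (z - a) \<le> r + \<epsilon>"
      using that by (simp add: dist_norm norm_minus_commute)
    have "norm (x - a) \<le> r"
      using mult_left_mono[OF z t(1)] t(1,3) by (simp add: x_def)
    moreover have "z - x = (1 - t) *\<^sub>R (z - a)"
      by (simp add: x_def algebra_simps)
    then have "norm (z - x) \<le> \<epsilon>"
      using mult_left_mono[OF z, of "1 - t"] t(2,4) by simp
    ultimately have "x \<in> cball a r" "z \<in> cball x \<epsilon>"
      by (simp_all add: dist_norm norm_minus_commute)
    with \<epsilon>(2) show ?thesis
      by blast
  qed
  then have "cball a (r + \<epsilon>) \<subseteq> U"
    by (rule subsetI)
  with \<epsilon>(1) that[of "r + \<epsilon>"] show thesis
    by simp
qed

lemma holomorphic_nhd_closed_disk_imp_in_St2: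
  assumes "open U" "cball 0 1 \<subseteq> U" "f holomorphic_on U"
  shows "f \<in> St2"
proof -
  obtain R where R: "1 < R" "cball 0 R \<subseteq> U"
    using cball_subset_open_imp_larger_cball_subset[OF assms(1,2)] by auto
  have hol: "f holomorphic_on cball 0 R"
    using assms(3) R(2) by (rule holomorphic_on_subset)
  have "bounded (f ` cball 0 R)"
    by (intro compact_imp_bounded compact_continuous_image compact_cball
        holomorphic_on_imp_continuous_on hol)
  then obtain B where "\<And>z. cmod z \<le> R \<Longrightarrow> cmod (f z) \<le> B"
    unfolding bounded_iff by (metis imageI mem_cball_0)
  with hol R show ?thesis
    by (intro St2_holomorphic_cball(1))
qed


section \<open>Riesz representation and adjoints\<close>

definition bounded_functional :: "((complex \<Rightarrow> complex) \<Rightarrow> complex) \<Rightarrow> bool" where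
  "bounded_functional L \<longleftrightarrow>
     (\<forall>f\<in>St2. \<forall>g\<in>St2. \<forall>c. L (\<lambda>z. c * f z + g z) = c * L f + L g) \<and>
     (\<exists>C. \<forall>f\<in>St2. cmod (L f) \<le> C * St2_norm f)"

definition bounded_op :: "((complex \<Rightarrow> complex) \<Rightarrow> (complex \<Rightarrow> complex)) \<Rightarrow> bool" where
  "bounded_op A \<longleftrightarrow>
     (\<forall>f\<in>St2. A f \<in> St2) \<and>
     (\<forall>f\<in>St2. \<forall>g\<in>St2. \<forall>c. disk_eq (A (\<lambda>z. c * f z + g z)) (\<lambda>z. c * A f z + A g z)) \<and>
     (\<exists>C. \<forall>f\<in>St2. St2_norm (A f) \<le> C * St2_norm f)"

lemma bounded_functional_linear:
  "bounded_functional L \<Longrightarrow> f \<in> St2 \<Longrightarrow> g \<in> St2 \<Longrightarrow> L (\<lambda>z. c * f z + g z) = c * L f + L g"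
  by (simp add: bounded_functional_def)

lemma bounded_op_in_St2: "bounded_op A \<Longrightarrow> f \<in> St2 \<Longrightarrow> A f \<in> St2"
  by (simp add: bounded_op_def)

lemma bounded_functional_bound:
  assumes "bounded_functional L"
  obtains C where "\<And>f. f \<in> St2 \<Longrightarrow> cmod (L f) \<le> C * St2_norm f"
  using assms unfolding bounded_functional_def by blast

lemma bounded_op_bound:
  assumes "bounded_op A"
  obtains C where "\<And>f. f \<in> St2 \<Longrightarrow> St2_norm (A f) \<le> C * St2_norm f"
  using assms unfolding bounded_op_def by blast

lemma bounded_functional_inner_right:
  assumes "h \<in> St2"
  shows "bounded_functional (\<lambda>f. St2_inner f h)"
  unfolding bounded_functional_def
proof (intro conjI ballI allI exI)
  show "cmod (St2_inner f h) \<le> St2_norm h * St2_norm f" if "f \<in> St2" for f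
    using St2_Cauchy_Schwarz(2)[OF that assms] by (simp add: mult.commute)
qed (use assms in \<open>simp add: St2_inner_linear_left\<close>)

lemma bounded_functional_inner_op:
  assumes A: "bounded_op A" and g: "g \<in> St2"
  shows "bounded_functional (\<lambda>f. St2_inner (A f) g)"
  unfolding bounded_functional_def
proof (intro conjI ballI allI)
  fix f h c assume f: "f \<in> St2" and h: "h \<in> St2"
  have "disk_eq (A (\<lambda>z. c * f z + h z)) (\<lambda>z. c * A f z + A h z)"
    using A f h by (simp add: bounded_op_def)
  from tcoeff_eq_if_disk_eq[OF this]
  have "St2_inner (A (\<lambda>z. c * f z + h z)) g = St2_inner (\<lambda>z. c * A f z + A h z) g"
    by (simp add: St2_inner_def)
  then show "St2_inner (A (\<lambda>z. c * f z + h z)) g = c * St2_inner (A f) g + St2_inner (A h) g"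
    by (simp add: St2_inner_linear_left bounded_op_in_St2[OF A] f g h)
next
  obtain C where C: "\<And>f. f \<in> St2 \<Longrightarrow> St2_norm (A f) \<le> C * St2_norm f"
    using bounded_op_bound[OF A] by blast
  have "cmod (St2_inner (A f) g) \<le> (C * St2_norm g) * St2_norm f" if f: "f \<in> St2" for f
  proof -
    have "cmod (St2_inner (A f) g) \<le> St2_norm (A f) * St2_norm g"
      by (intro St2_Cauchy_Schwarz bounded_op_in_St2[OF A] f g)
    also have "\<dots> \<le> (C * St2_norm f) * St2_norm g"
      by (intro mult_right_mono C f St2_norm_nonneg g)
    finally show ?thesis
      by (simp only: ac_simps)
  qed
  then show "\<exists>C. \<forall>f\<in>St2. cmod (St2_inner (A f) g) \<le> C * St2_norm f"
    by blast
qed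

lemma bounded_functional_zero:
  assumes "bounded_functional L"
  shows "L (\<lambda>_. 0) = 0"
  using bounded_functional_linear[OF assms zero_in_St2 zero_in_St2, of 1] by simp

lemma bounded_functional_polynomial:
  assumes "bounded_functional L"
  shows "L (\<lambda>z. \<Sum>n<N. a n * z ^ n) = (\<Sum>n<N. a n * L (\<lambda>z. z ^ n))"
proof (induction N)
  case 0
  show ?case
    by (simp add: bounded_functional_zero assms)
next
  case (Suc N)
  have "L (\<lambda>z. \<Sum>n<Suc N. a n * z ^ n) = L (\<lambda>z. a N * z ^ N + (\<Sum>n<N. a n * z ^ n))"
    by (simp add: add.commute)
  also have "\<dots> = a N * L (\<lambda>z. z ^ N) + L (\<lambda>z. \<Sum>n<N. a n * z ^ n)"
    by (rule bounded_functional_linear[OF assms power_in_St2 polynomial_in_St2])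
  finally show ?case
    by (simp add: Suc.IH add.commute)
qed

lemma bounded_functional_taylor_polynomial_tendsto:
  assumes L: "bounded_functional L" and f: "f \<in> St2"
  shows "(\<lambda>N. L (\<lambda>z. \<Sum>n<N. tcoeff f n * z ^ n)) \<longlonglongrightarrow> L f"
proof -
  obtain C where C: "\<And>f. f \<in> St2 \<Longrightarrow> cmod (L f) \<le> C * St2_norm f"
    using bounded_functional_bound[OF L] by blast
  let ?p = "\<lambda>N z. \<Sum>n<N. tcoeff f n * z ^ n"
  let ?rem = "\<lambda>N z. f z - ?p N z"
  have "(\<lambda>N. L (?rem N)) \<longlonglongrightarrow> 0"
  proof (rule Lim_null_comparison)
    show "(\<lambda>N. C * St2_norm (?rem N)) \<longlonglongrightarrow> 0"
      using tendsto_mult_left[OF St2_taylor_remainder_tendsto_0[OF f], of C] by simp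
    show "\<forall>\<^sub>F N in sequentially. cmod (L (?rem N)) \<le> C * St2_norm (?rem N)"
      using St2_linear_combination(1)[OF polynomial_in_St2 f, of "- 1"]
      by (intro always_eventually allI C) simp
  qed
  moreover have "L (?rem N) = L f - L (?p N)" for N
    using bounded_functional_linear[OF L polynomial_in_St2 f, of "- 1"] by simp
  ultimately have "(\<lambda>N. L f - L (?p N)) \<longlonglongrightarrow> 0"
    by simp
  from tendsto_diff[OF tendsto_const[of "L f"] this] show ?thesis
    by simp
qed

lemma St2_Riesz_representation:
  assumes L: "bounded_functional L"
  obtains h where "h \<in> St2" "\<And>f. f \<in> St2 \<Longrightarrow> L f = St2_inner f h"
proof -
  obtain C where C: "\<And>f. f \<in> St2 \<Longrightarrow> cmod (L f) \<le> C * St2_norm f"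
    using bounded_functional_bound[OF L] by blast
  define b where "b n = cnj (L (\<lambda>z. z ^ n)) / of_real (wt2 n)" for n
  have L_power: "L (\<lambda>z. z ^ n) = of_real (wt2 n) * cnj (b n)" for n
    by (simp add: b_def)
  have "L2_set (weighted_modulus b) {..<N} \<le> max C 0" for N
  proof -
    let ?S = "L2_set (weighted_modulus b) {..<N}"
    have "L (\<lambda>z. \<Sum>n<N. b n * z ^ n) = of_real (\<Sum>n<N. wt2 n * (cmod (b n))\<^sup>2)"
      unfolding bounded_functional_polynomial[OF L] L_power of_real_sum of_real_mult complex_norm_square
      by (simp only: ac_simps)
    also have "\<dots> = of_real (?S\<^sup>2)"
      by (simp add: L2_set_weighted_modulus sum_nonneg)
    finally have "?S\<^sup>2 \<le> C * ?S"
      using C[OF polynomial_in_St2, of b N] by (simp add: St2_norm_polynomial norm_power)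
    then have "?S \<le> C" if "?S \<noteq> 0"
      using that L2_set_nonneg[of "weighted_modulus b" "{..<N}"]
      by (simp add: power2_eq_square mult_le_cancel_right order_less_le)
    then show ?thesis
      by (cases "?S = 0") auto
  qed
  then obtain h where h: "h \<in> St2" "tcoeff h = b"
    using St2_power_series by blast
  have "L f = St2_inner f h" if f: "f \<in> St2" for f
  proof (rule LIMSEQ_unique)
    show "(\<lambda>N. L (\<lambda>z. \<Sum>n<N. tcoeff f n * z ^ n)) \<longlonglongrightarrow> L f"
      by (rule bounded_functional_taylor_polynomial_tendsto[OF L f])
    show "(\<lambda>N. L (\<lambda>z. \<Sum>n<N. tcoeff f n * z ^ n)) \<longlonglongrightarrow> St2_inner f h"
      using St2_inner_sums[OF f h(1)]
      by (simp add: sums_def bounded_functional_polynomial[OF L] L_power h(2) ac_simps)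
  qed
  with h(1) that show thesis by blast
qed

lemma bounded_op_imp_is_adjoint:
  assumes "bounded_op A"
  obtains B where "is_adjoint A B"
proof -
  have "\<exists>h\<in>St2. \<forall>f\<in>St2. St2_inner (A f) g = St2_inner f h" if "g \<in> St2" for g
    using St2_Riesz_representation[OF bounded_functional_inner_op[OF assms that]] by metis
  then obtain B where "\<forall>g\<in>St2. B g \<in> St2 \<and> (\<forall>f\<in>St2. St2_inner (A f) g = St2_inner f (B g))"
    by metis
  then show thesis
    by (intro that[of B]) (simp add: is_adjoint_def)
qed

lemma is_adjoint_compose:
  assumes "is_adjoint A A'" "is_adjoint B B'" "bounded_op B"
  shows "is_adjoint (\<lambda>f. A (B f)) (\<lambda>g. B' (A' g))"
  using assms by (auto simp: is_adjoint_def bounded_op_in_St2)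


section \<open>Finite rank operators\<close>

lemma finite_rank_op_iff:
  "finite_rank_op K \<longleftrightarrow> bounded_op K \<and>
     (\<exists>F. finite F \<and> F \<subseteq> St2 \<and> (\<forall>f\<in>St2. \<exists>c. disk_eq (K f) (\<lambda>z. \<Sum>h\<in>F. c h * h z)))"
  by (auto simp: finite_rank_op_def bounded_op_def)

lemma finite_rank_op_rank_one:
  assumes L: "bounded_functional L" and u: "u \<in> St2"
  shows "finite_rank_op (\<lambda>f z. L f * u z)"
proof -
  obtain C where C: "\<And>f. f \<in> St2 \<Longrightarrow> cmod (L f) \<le> C * St2_norm f"
    using bounded_functional_bound[OF L] by blast
  have "bounded_op (\<lambda>f z. L f * u z)"
    unfolding bounded_op_def
  proof (intro conjI ballI allI exI)
    show "St2_norm (\<lambda>z. L f * u z) \<le> (C * St2_norm u) * St2_norm f" if f: "f \<in> St2" for f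
    proof -
      have "cmod (L f) * St2_norm u \<le> (C * St2_norm f) * St2_norm u"
        by (intro mult_right_mono C f St2_norm_nonneg u)
      with St2_cmult(2)[OF u, of "L f"] show ?thesis
        by (simp add: ac_simps)
    qed
  qed (simp_all add: St2_cmult(1) u disk_eq_def bounded_functional_linear[OF L] distrib_right mult.assoc)
  then show ?thesis
    unfolding finite_rank_op_iff using u
    by (auto simp: disk_eq_def intro!: exI[of _ "{u}"])
qed

lemma bounded_op_linear_combination:
  assumes K: "bounded_op K" and L: "bounded_op L"
  shows "bounded_op (\<lambda>f z. a * K f z + L f z)"
proof -
  obtain C D where bounds: "\<And>f. f \<in> St2 \<Longrightarrow> St2_norm (K f) \<le> C * St2_norm f"
    "\<And>f. f \<in> St2 \<Longrightarrow> St2_norm (L f) \<le> D * St2_norm f"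
    using bounded_op_bound[OF K] bounded_op_bound[OF L] by metis
  show ?thesis
    unfolding bounded_op_def
  proof (intro conjI ballI allI exI)
    show "(\<lambda>z. a * K f z + L f z) \<in> St2" if "f \<in> St2" for f
      by (intro St2_linear_combination bounded_op_in_St2[OF K] bounded_op_in_St2[OF L] that)
    show "St2_norm (\<lambda>z. a * K f z + L f z) \<le> (cmod a * C + D) * St2_norm f" if f: "f \<in> St2" for f
    proof -
      have "St2_norm (\<lambda>z. a * K f z + L f z) \<le> cmod a * St2_norm (K f) + St2_norm (L f)"
        by (intro St2_linear_combination bounded_op_in_St2[OF K] bounded_op_in_St2[OF L] f)
      also have "\<dots> \<le> cmod a * (C * St2_norm f) + D * St2_norm f"
        by (intro add_mono mult_left_mono bounds f) auto
      finally show ?thesis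
        by (simp add: algebra_simps)
    qed
    show "disk_eq (\<lambda>z. a * K (\<lambda>z. c * f z + g z) z + L (\<lambda>z. c * f z + g z) z)
        (\<lambda>z. c * (a * K f z + L f z) + (a * K g z + L g z))" if "f \<in> St2" "g \<in> St2" for f g c
      using K L that by (simp add: bounded_op_def disk_eq_def algebra_simps)
  qed
qed

lemma finite_rank_op_linear_combination:
  assumes "finite_rank_op K" "finite_rank_op L"
  shows "finite_rank_op (\<lambda>f z. a * K f z + L f z)"
proof -
  obtain F G where F: "finite F" "F \<subseteq> St2" "\<forall>f\<in>St2. \<exists>c. disk_eq (K f) (\<lambda>z. \<Sum>h\<in>F. c h * h z)"
    and G: "finite G" "G \<subseteq> St2" "\<forall>f\<in>St2. \<exists>c. disk_eq (L f) (\<lambda>z. \<Sum>h\<in>G. c h * h z)"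
    using assms unfolding finite_rank_op_iff by blast
  have "\<exists>c. disk_eq (\<lambda>z. a * K f z + L f z) (\<lambda>z. \<Sum>h\<in>F \<union> G. c h * h z)" if f: "f \<in> St2" for f
  proof -
    obtain c d where cd: "disk_eq (K f) (\<lambda>z. \<Sum>h\<in>F. c h * h z)" "disk_eq (L f) (\<lambda>z. \<Sum>h\<in>G. d h * h z)"
      using F(3) G(3) f by blast
    let ?c = "\<lambda>h. a * (if h \<in> F then c h else 0) + (if h \<in> G then d h else 0)"
    have "(\<Sum>h\<in>F \<union> G. (if h \<in> F then c h else 0) * h z) = (\<Sum>h\<in>F. c h * h z)"
      "(\<Sum>h\<in>F \<union> G. (if h \<in> G then d h else 0) * h z) = (\<Sum>h\<in>G. d h * h z)" for z
      using F(1) G(1) by (auto intro!: sum.mono_neutral_cong_right)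
    then have "(\<Sum>h\<in>F \<union> G. ?c h * h z) = a * (\<Sum>h\<in>F. c h * h z) + (\<Sum>h\<in>G. d h * h z)" for z
      by (simp add: distrib_right sum.distrib mult.assoc flip: sum_distrib_left)
    with cd show ?thesis
      by (intro exI[of _ ?c]) (simp add: disk_eq_def)
  qed
  with F(1,2) G(1,2) assms show ?thesis
    unfolding finite_rank_op_iff
    by (intro conjI exI[of _ "F \<union> G"] bounded_op_linear_combination) auto
qed


section \<open>Reproducing kernels\<close>

lemma cmod_mult_less_1: "cmod x < 1 \<Longrightarrow> cmod y < 1 \<Longrightarrow> cmod (x * y) < 1"
  using mult_strict_mono'[of "cmod x" 1 "cmod y" 1] by (simp add: norm_mult)

lemma Re_one_minus_pos: "cmod x < 1 \<Longrightarrow> 0 < Re (1 - x)"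
  using complex_Re_le_cmod[of x] by simp

lemma one_minus_notin_nonpos_Reals: "cmod x < 1 \<Longrightarrow> 1 - x \<notin> \<real>\<^sub>\<le>\<^sub>0"
  using Re_one_minus_pos[of x] by (auto simp: complex_nonpos_Reals_iff)

definition log_kernel :: "complex \<Rightarrow> complex \<Rightarrow> complex" where
  "log_kernel s = (\<lambda>z. 1 - Ln (1 - cnj s * z))"

definition St2_kernel :: "complex \<Rightarrow> complex \<Rightarrow> complex" where
  "St2_kernel s = (\<lambda>z. 1 + 2 * (cnj s * z) + (1 - cnj s * z) * Ln (1 - cnj s * z))"

definition St2_deriv_kernel :: "complex \<Rightarrow> complex \<Rightarrow> complex" where
  "St2_deriv_kernel s = Tz (log_kernel s)"

lemma log_kernel_holomorphic:
  "log_kernel s holomorphic_on {z. cmod (cnj s * z) < 1}"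
  unfolding log_kernel_def
  by (intro holomorphic_intros) (auto dest: one_minus_notin_nonpos_Reals simp del: norm_mult)

lemma log_kernel_holomorphic_unit_disk:
  "cmod s < 1 \<Longrightarrow> log_kernel s holomorphic_on ball 0 1"
  by (rule holomorphic_on_subset[OF log_kernel_holomorphic]) (auto intro: cmod_mult_less_1)

lemma holomorphic_kernel_domain_imp_in_St2:
  assumes "cmod s < 1" "f holomorphic_on {z. cmod (cnj s * z) < 1}"
  shows "f \<in> St2"
proof (rule holomorphic_nhd_closed_disk_imp_in_St2[OF _ _ assms(2)])
  show "open {z. cmod (cnj s * z) < 1}"
    by (intro open_Collect_less continuous_intros)
  have "cmod s * cmod z < 1" if "cmod z \<le> 1" for z :: complex
    using mult_left_mono[OF that, of "cmod s"] assms(1) by simp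
  then show "cball 0 1 \<subseteq> {z. cmod (cnj s * z) < 1}"
    by (auto simp: norm_mult)
qed

lemma St2_kernel_in_St2: "cmod s < 1 \<Longrightarrow> St2_kernel s \<in> St2"
  unfolding St2_kernel_def
  by (intro holomorphic_kernel_domain_imp_in_St2 holomorphic_intros)
     (auto dest: one_minus_notin_nonpos_Reals simp del: norm_mult)

lemma St2_deriv_kernel_in_St2: "cmod s < 1 \<Longrightarrow> St2_deriv_kernel s \<in> St2"
  unfolding St2_deriv_kernel_def Tz_def
  by (rule holomorphic_kernel_domain_imp_in_St2)
     (auto intro!: holomorphic_intros log_kernel_holomorphic simp del: norm_mult)

lemma tcoeff_log_kernel:
  assumes "cmod s < 1"
  shows "tcoeff (log_kernel s) = (\<lambda>n. of_nat (Suc n) * cnj s ^ n / of_real (wt2 (Suc n)))"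
proof (rule tcoeff_eqI)
  fix z :: complex assume "cmod z < 1"
  with assms have "cmod (- (cnj s * z)) < 1"
    by (simp add: cmod_mult_less_1)
  from sums_diff[OF sums_single[of 0 "\<lambda>_. 1"] Ln_series'[OF this]]
  have "(\<lambda>n. (if n = 0 then 1 else 0) + (cnj s * z) ^ n / of_nat n) sums log_kernel s z"
    by (simp add: log_kernel_def)
  also have "(\<lambda>n. (if n = 0 then 1 else 0) + (cnj s * z) ^ n / of_nat n)
      = (\<lambda>n. of_nat (Suc n) * cnj s ^ n / of_real (wt2 (Suc n)) * z ^ n)"
  proof
    fix n
    have "of_nat (Suc n) \<noteq> (0 :: complex)"
      by (rule of_nat_neq_0)
    then show "(if n = 0 then 1 else 0) + (cnj s * z) ^ n / of_nat n
        = of_nat (Suc n) * cnj s ^ n / of_real (wt2 (Suc n)) * z ^ n"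
      by (simp add: wt2_def power_mult_distrib)
  qed
  finally show "(\<lambda>n. of_nat (Suc n) * cnj s ^ n / of_real (wt2 (Suc n)) * z ^ n) sums log_kernel s z" .
qed

lemma cnj_log_kernel:
  assumes "cmod (cnj s * z) < 1"
  shows "cnj (log_kernel s z) = log_kernel z s"
  using cnj_Ln[OF one_minus_notin_nonpos_Reals[OF assms]] by (simp add: log_kernel_def mult.commute)

lemma deriv_St2_kernel:
  assumes "cmod (cnj s * z) < 1"
  shows "deriv (St2_kernel s) z = cnj s * log_kernel s z"
proof (rule DERIV_imp_deriv)
  define q where "q = 1 - cnj s * z"
  have "q \<notin> \<real>\<^sub>\<le>\<^sub>0"
    unfolding q_def by (rule one_minus_notin_nonpos_Reals[OF assms])
  then have "(St2_kernel s has_field_derivative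
      2 * cnj s + (- cnj s * Ln q + (- cnj s / q) * q)) (at z)"
    unfolding St2_kernel_def q_def by (auto intro!: derivative_eq_intros)
  also have "2 * cnj s + (- cnj s * Ln q + (- cnj s / q) * q) = cnj s * (1 - Ln q)"
    using \<open>q \<notin> \<real>\<^sub>\<le>\<^sub>0\<close> by (cases "q = 0") (auto simp: right_diff_distrib)
  finally show "(St2_kernel s has_field_derivative cnj s * log_kernel s z) (at z)"
    by (simp add: log_kernel_def q_def)
qed

lemma tcoeff_St2_kernel:
  assumes "cmod s < 1"
  shows "tcoeff (St2_kernel s) n = cnj s ^ n / of_real (wt2 n)"
proof (cases n)
  case 0
  then show ?thesis
    by (simp add: tcoeff_def St2_kernel_def wt2_def)
next
  case (Suc m)
  have "disk_eq (deriv (St2_kernel s)) (\<lambda>z. cnj s * log_kernel s z)"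
    using assms by (auto simp: disk_eq_def intro!: deriv_St2_kernel cmod_mult_less_1)
  from tcoeff_eq_if_disk_eq[OF this]
  have "tcoeff (deriv (St2_kernel s)) m = cnj s * tcoeff (log_kernel s) m"
    by (simp add: tcoeff_cmult log_kernel_holomorphic_unit_disk assms)
  then show ?thesis
    using Suc of_nat_neq_0[of m, where 'a = complex]
    by (simp add: tcoeff_deriv tcoeff_log_kernel[OF assms] field_simps del: of_nat_Suc)
qed

lemma tcoeff_St2_deriv_kernel:
  assumes "cmod s < 1"
  shows "tcoeff (St2_deriv_kernel s) n = of_nat n * cnj s ^ (n - 1) / of_real (wt2 n)"
  using tcoeff_Tz[OF log_kernel_holomorphic_unit_disk[OF assms]]
  by (simp add: St2_deriv_kernel_def tcoeff_log_kernel[OF assms] split: nat.split)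

lemma St2_deriv_kernel_0: "St2_deriv_kernel 0 z = z"
  by (simp add: St2_deriv_kernel_def log_kernel_def Tz_def)

lemma St2_inner_kernel:
  assumes f: "f \<in> St2" and s: "cmod s < 1"
  shows "St2_inner f (St2_kernel s) = f s"
proof (rule sums_unique2)
  show "(\<lambda>n. tcoeff f n * s ^ n) sums St2_inner f (St2_kernel s)"
    using St2_inner_sums[OF f St2_kernel_in_St2[OF s]] by (simp add: tcoeff_St2_kernel[OF s])
  show "(\<lambda>n. tcoeff f n * s ^ n) sums f s"
    by (rule sums_tcoeff[OF St2_holomorphic[OF f] s])
qed

lemma St2_inner_deriv_kernel:
  assumes f: "f \<in> St2" and s: "cmod s < 1"
  shows "St2_inner f (St2_deriv_kernel s) = deriv f s"
proof (rule sums_unique2)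
  let ?t = "\<lambda>n. of_nat n * tcoeff f n * s ^ (n - 1)"
  have "(\<lambda>n. of_real (wt2 n) * tcoeff f n * cnj (tcoeff (St2_deriv_kernel s) n)) = ?t"
    by (simp add: tcoeff_St2_deriv_kernel[OF s] fun_eq_iff)
  then show "?t sums St2_inner f (St2_deriv_kernel s)"
    using St2_inner_sums[OF f St2_deriv_kernel_in_St2[OF s]] by simp
  have "(\<lambda>n. ?t (Suc n)) sums deriv f s"
    using sums_tcoeff[OF St2_deriv_holomorphic[OF f] s] by (simp add: tcoeff_deriv)
  from sums_Suc[OF this] show "?t sums deriv f s"
    by simp
qed

lemma bounded_functional_deriv:
  assumes "cmod s < 1"
  shows "bounded_functional (\<lambda>f. deriv f s)"
  using bounded_functional_inner_right[OF St2_deriv_kernel_in_St2[OF assms]]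
  by (simp add: bounded_functional_def St2_inner_deriv_kernel[OF _ assms] St2_linear_combination)

lemma St2_deriv_bounded:
  assumes r: "0 \<le> r" "r < 1"
  obtains C where "\<And>f s. f \<in> St2 \<Longrightarrow> cmod s \<le> r \<Longrightarrow> cmod (deriv f s) \<le> C * St2_norm f"
proof -
  let ?k = "St2_deriv_kernel (of_real r)"
  have "cmod (deriv f s) \<le> St2_norm ?k * St2_norm f" if f: "f \<in> St2" and s: "cmod s \<le> r" for f s
  proof -
    have s_in_disk: "cmod s < 1" and r_in_disk: "cmod (complex_of_real r) < 1"
      using s r by simp_all
    have "St2_norm (St2_deriv_kernel s) \<le> St2_norm ?k"
    proof (rule St2I_L2_set(2))
      show "St2_deriv_kernel s holomorphic_on ball 0 1"
        by (intro St2_holomorphic St2_deriv_kernel_in_St2 s_in_disk)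
      fix N
      have "weighted_modulus (tcoeff (St2_deriv_kernel s)) n \<le> weighted_modulus (tcoeff ?k) n" for n
        unfolding weighted_modulus_def using s r
        by (simp add: tcoeff_St2_deriv_kernel[OF s_in_disk] tcoeff_St2_deriv_kernel[OF r_in_disk] norm_mult
            norm_divide norm_power mult_left_mono divide_right_mono power_mono)
      then have "L2_set (weighted_modulus (tcoeff (St2_deriv_kernel s))) {..<N}
          \<le> L2_set (weighted_modulus (tcoeff ?k)) {..<N}"
        by (intro L2_set_mono) auto
      also have "\<dots> \<le> St2_norm ?k"
        by (intro L2_set_le_St2_norm St2_deriv_kernel_in_St2 r_in_disk)
      finally show "L2_set (weighted_modulus (tcoeff (St2_deriv_kernel s))) {..<N} \<le> St2_norm ?k" .
    qed
    then have "St2_norm f * St2_norm (St2_deriv_kernel s) \<le> St2_norm f * St2_norm ?k"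
      by (intro mult_left_mono St2_norm_nonneg f)
    with St2_Cauchy_Schwarz(2)[OF f St2_deriv_kernel_in_St2[OF s_in_disk]] show ?thesis
      by (simp add: St2_inner_deriv_kernel[OF f s_in_disk] mult.commute)
  qed
  then show thesis by (rule that)
qed

lemma adjoint_eq_inner_kernel:
  assumes "is_adjoint A B" "A (St2_kernel \<zeta>) \<in> St2" "g \<in> St2" "cmod \<zeta> < 1"
  shows "B g \<zeta> = St2_inner g (A (St2_kernel \<zeta>))"
proof -
  note kernel = St2_kernel_in_St2[OF assms(4)]
  have B: "B g \<in> St2" and adjoint: "St2_inner (A (St2_kernel \<zeta>)) g = St2_inner (St2_kernel \<zeta>) (B g)"
    using assms(1,3) kernel by (auto simp: is_adjoint_def)
  have "B g \<zeta> = St2_inner (B g) (St2_kernel \<zeta>)"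
    using St2_inner_kernel[OF B assms(4)] by simp
  also have "\<dots> = cnj (St2_inner (A (St2_kernel \<zeta>)) g)"
    unfolding adjoint by (rule St2_inner_commute[OF kernel B])
  also have "\<dots> = St2_inner g (A (St2_kernel \<zeta>))"
    by (rule St2_inner_commute[OF assms(2,3), symmetric])
  finally show ?thesis .
qed


section \<open>Boundedness of \<open>T\<^sub>z\<close> and \<open>D\<^sub>\<phi>\<close>\<close>

lemma bounded_op_Tz: "bounded_op Tz"
proof -
  have Tz: "Tz f \<in> St2" "St2_norm (Tz f) \<le> 2 * St2_norm f" if f: "f \<in> St2" for f
  proof -
    have "L2_set (weighted_modulus (tcoeff (Tz f))) {..<N} \<le> 2 * St2_norm f" for N
    proof (cases N)
      case (Suc M)
      have "(\<Sum>n<N. wt2 n * (cmod (tcoeff (Tz f) n))\<^sup>2)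
          = (\<Sum>n<M. wt2 (Suc n) * (cmod (tcoeff f n))\<^sup>2)"
        by (simp add: Suc sum.lessThan_Suc_shift tcoeff_Tz[OF St2_holomorphic[OF f]]
            del: sum.lessThan_Suc)
      also have "\<dots> \<le> (\<Sum>n<M. 2\<^sup>2 * (wt2 n * (cmod (tcoeff f n))\<^sup>2))"
        by (intro sum_mono) (simp add: wt2_Suc_le mult_right_mono flip: mult.assoc)
      also have "\<dots> = 2\<^sup>2 * (\<Sum>n<M. wt2 n * (cmod (tcoeff f n))\<^sup>2)"
        by (rule sum_distrib_left[symmetric])
      finally have "L2_set (weighted_modulus (tcoeff (Tz f))) {..<N}
          \<le> sqrt (2\<^sup>2 * (\<Sum>n<M. wt2 n * (cmod (tcoeff f n))\<^sup>2))"
        unfolding L2_set_weighted_modulus by (rule real_sqrt_le_mono)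
      also have "\<dots> = 2 * L2_set (weighted_modulus (tcoeff f)) {..<M}"
        by (simp add: L2_set_weighted_modulus real_sqrt_mult)
      also have "\<dots> \<le> 2 * St2_norm f"
        by (simp add: L2_set_le_St2_norm f)
      finally show ?thesis .
    qed (simp add: St2_norm_nonneg f)
    moreover have "Tz f holomorphic_on ball 0 1"
      unfolding Tz_def by (intro holomorphic_intros St2_holomorphic f)
    ultimately show "Tz f \<in> St2" "St2_norm (Tz f) \<le> 2 * St2_norm f"
      using St2I_L2_set by blast+
  qed
  then show ?thesis
    unfolding bounded_op_def
    by (intro conjI exI[of _ 2] ballI allI) (auto simp: disk_eq_def Tz_def algebra_simps)
qed

lemma holomorphic_nhd_closed_disk_into_disk:
  assumes U: "open U" "cball 0 1 \<subseteq> U" and hol: "\<phi> holomorphic_on U"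
    and into: "\<phi> ` U \<subseteq> ball 0 1"
  obtains R r where "1 < R" "\<phi> holomorphic_on cball 0 R" "0 \<le> r" "r < 1"
    "\<And>z. cmod z \<le> R \<Longrightarrow> cmod (\<phi> z) \<le> r"
proof -
  obtain R where R: "1 < R" "cball 0 R \<subseteq> U"
    using cball_subset_open_imp_larger_cball_subset[OF U] by auto
  have hol_R: "\<phi> holomorphic_on cball 0 R"
    using hol R(2) by (rule holomorphic_on_subset)
  then have "continuous_on (cball 0 R) (\<lambda>z. cmod (\<phi> z))"
    by (intro continuous_on_norm holomorphic_on_imp_continuous_on)
  moreover have "cball (0::complex) R \<noteq> {}"
    using R(1) by simp
  ultimately obtain z0 where z0: "z0 \<in> cball 0 R" "\<forall>z\<in>cball 0 R. cmod (\<phi> z) \<le> cmod (\<phi> z0)"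
    using continuous_attains_sup[OF compact_cball] by blast
  have "\<phi> z0 \<in> ball 0 1"
    using z0(1) R(2) into by blast
  show thesis
  proof
    show "cmod (\<phi> z0) < 1"
      using \<open>\<phi> z0 \<in> ball 0 1\<close> by simp
    show "cmod (\<phi> z) \<le> cmod (\<phi> z0)" if "cmod z \<le> R" for z
      using z0(2) that by simp
  qed (use R(1) hol_R in simp_all)
qed

lemma Dop_bound:
  assumes "1 < R" and hol: "\<phi> holomorphic_on cball 0 R"
    and "r < 1" and \<phi>_le: "\<And>z. cmod z \<le> R \<Longrightarrow> cmod (\<phi> z) \<le> r"
    and f: "f \<in> St2" and deriv_le: "\<And>s. cmod s \<le> r \<Longrightarrow> cmod (deriv f s) \<le> B"
  shows "Dop \<phi> f \<in> St2" and "St2_norm (Dop \<phi> f) \<le> B / (1 - 1 / R)\<^sup>2"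
proof -
  have "\<phi> ` cball 0 R \<subseteq> ball 0 1"
    using \<phi>_le \<open>r < 1\<close> by (force simp: image_subset_iff)
  from holomorphic_on_compose_gen[OF hol St2_deriv_holomorphic[OF f] this]
  have "Dop \<phi> f holomorphic_on cball 0 R"
    by (simp add: Dop_def o_def)
  moreover have "cmod (Dop \<phi> f z) \<le> B" if "cmod z \<le> R" for z
    using that by (simp add: Dop_def deriv_le \<phi>_le)
  ultimately show "Dop \<phi> f \<in> St2" "St2_norm (Dop \<phi> f) \<le> B / (1 - 1 / R)\<^sup>2"
    using St2_holomorphic_cball[OF _ \<open>1 < R\<close>] by blast+
qed

lemma bounded_op_Dop:
  assumes "open U" "cball 0 1 \<subseteq> U" "\<phi> holomorphic_on U" "\<phi> ` U \<subseteq> ball 0 1"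
  shows "bounded_op (Dop \<phi>)"
proof -
  obtain R r where \<phi>: "1 < R" "\<phi> holomorphic_on cball 0 R" "0 \<le> r" "r < 1"
      "\<And>z. cmod z \<le> R \<Longrightarrow> cmod (\<phi> z) \<le> r"
    by (rule holomorphic_nhd_closed_disk_into_disk[OF assms]) (rule that)
  obtain C where C: "\<And>f s. f \<in> St2 \<Longrightarrow> cmod s \<le> r \<Longrightarrow> cmod (deriv f s) \<le> C * St2_norm f"
    using St2_deriv_bounded[OF \<phi>(3,4)] by blast
  show ?thesis
    unfolding bounded_op_def
  proof (intro conjI ballI allI exI)
    fix f assume f: "f \<in> St2"
    show "Dop \<phi> f \<in> St2"
      by (rule Dop_bound(1)[OF \<phi>(1,2,4,5) f C[OF f]])
    show "St2_norm (Dop \<phi> f) \<le> (C / (1 - 1 / R)\<^sup>2) * St2_norm f"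
      using Dop_bound(2)[OF \<phi>(1,2,4,5) f C[OF f]] by simp
  next
    fix f g c assume fg: "f \<in> St2" "g \<in> St2"
    have "cmod (\<phi> z) < 1" if "cmod z < 1" for z
      using \<phi>(5)[of z] that \<phi>(1,4) by simp
    then show "disk_eq (Dop \<phi> (\<lambda>z. c * f z + g z)) (\<lambda>z. c * Dop \<phi> f z + Dop \<phi> g z)"
      using bounded_functional_linear[OF bounded_functional_deriv fg]
      by (simp add: disk_eq_def Dop_def)
  qed
qed


section \<open>Linear fractional symbols and the Krein adjoint\<close>

lemma Ln_mult_right_half_plane:
  assumes "0 < Re p" "0 < Re q"
  shows "Ln (p * q) = Ln p + Ln q"
proof (rule Ln_times_simple)
  show "- pi < Im (Ln p) + Im (Ln q)" "Im (Ln p) + Im (Ln q) \<le> pi"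
    using assms[THEN Re_Ln_pos_lt_imp] by linarith+
qed (use assms in auto)

locale moebius_into_disk =
  fixes a b c d :: complex
  assumes denominator_nonzero: "\<And>z. cmod z \<le> 1 \<Longrightarrow> c * z + d \<noteq> 0"
    and into_disk: "\<And>z. cmod z \<le> 1 \<Longrightarrow> cmod ((a * z + b) / (c * z + d)) < 1"
begin

definition \<phi> :: "complex \<Rightarrow> complex" where
  "\<phi> z = (a * z + b) / (c * z + d)"

definition \<sigma> :: "complex \<Rightarrow> complex" where
  "\<sigma> z = (cnj a * z - cnj c) / (- cnj b * z + cnj d)"

lemma cmod_phi_less_1: "cmod z \<le> 1 \<Longrightarrow> cmod (\<phi> z) < 1"
  using into_disk by (simp add: \<phi>_def)

lemma bounded_op_Dop_phi: "bounded_op (Dop \<phi>)"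
proof (rule bounded_op_Dop)
  let ?U = "{z. cmod (a * z + b) < cmod (c * z + d)}"
  show "open ?U"
    by (intro open_Collect_less continuous_intros)
  show "cball 0 1 \<subseteq> ?U"
  proof
    fix z :: complex assume "z \<in> cball 0 1"
    then show "z \<in> ?U"
      using into_disk[of z] denominator_nonzero[of z] by (simp add: norm_divide divide_less_eq)
  qed
  show "\<phi> holomorphic_on ?U"
    unfolding \<phi>_def by (intro holomorphic_intros) auto
  show "\<phi> ` ?U \<subseteq> ball 0 1"
    by (auto simp: \<phi>_def norm_divide divide_less_eq)
qed

lemma sigma_denominator_nonzero:
  assumes "cmod \<zeta> < 1"
  shows "d - b * cnj \<zeta> \<noteq> 0"
proof
  have "d \<noteq> 0"
    using denominator_nonzero[of 0] by simp
  moreover assume "d - b * cnj \<zeta> = 0"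
  then have "cnj \<zeta> * b = d"
    by (simp add: mult.commute)
  ultimately have "cnj \<zeta> * \<phi> 0 = 1"
    by (simp add: \<phi>_def)
  moreover have "cmod (cnj \<zeta> * \<phi> 0) < 1"
    using assms by (intro cmod_mult_less_1 cmod_phi_less_1) auto
  ultimately show False by simp
qed

lemma Krein_identity:
  assumes "cmod \<zeta> < 1" "cmod w \<le> 1"
  shows "(c * w + d) * (1 - cnj \<zeta> * \<phi> w) = (d - b * cnj \<zeta>) * (1 - cnj (\<sigma> \<zeta>) * w)"
proof -
  have \<phi>: "(c * w + d) * \<phi> w = a * w + b"
    using denominator_nonzero[OF assms(2)] by (simp add: \<phi>_def)
  have \<sigma>: "(d - b * cnj \<zeta>) * cnj (\<sigma> \<zeta>) = a * cnj \<zeta> - c"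
    using sigma_denominator_nonzero[OF assms(1)] by (simp add: \<sigma>_def)
  have "(c * w + d) * (1 - cnj \<zeta> * \<phi> w) = (c * w + d) - cnj \<zeta> * ((c * w + d) * \<phi> w)"
    by (simp only: right_diff_distrib mult_1_right mult.left_commute)
  also have "\<dots> = (d - b * cnj \<zeta>) - (d - b * cnj \<zeta>) * cnj (\<sigma> \<zeta>) * w"
    unfolding \<phi> \<sigma> by (simp add: algebra_simps)
  also have "\<dots> = (d - b * cnj \<zeta>) * (1 - cnj (\<sigma> \<zeta>) * w)"
    by (simp only: right_diff_distrib mult_1_right mult.assoc)
  finally show ?thesis .
qed

lemma cmod_sigma_less_1:
  assumes \<zeta>: "cmod \<zeta> < 1"
  shows "cmod (\<sigma> \<zeta>) < 1"
proof (rule ccontr)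
  assume outside: "\<not> cmod (\<sigma> \<zeta>) < 1"
  define w where "w = 1 / cnj (\<sigma> \<zeta>)"
  have w: "cmod w \<le> 1" "cnj (\<sigma> \<zeta>) * w = 1"
    using outside by (auto simp: w_def norm_divide divide_le_eq)
  then have "cnj \<zeta> * \<phi> w = 1"
    using Krein_identity[OF \<zeta> w(1)] denominator_nonzero[OF w(1)] by simp
  moreover have "cmod (cnj \<zeta> * \<phi> w) < 1"
    using \<zeta> w(1) by (intro cmod_mult_less_1 cmod_phi_less_1) auto
  ultimately show False by simp
qed

lemma Krein_identity_normalized:
  assumes "cmod \<zeta> < 1" "cmod w \<le> 1"
  shows "(1 - cnj \<zeta> * \<phi> w) * (1 - cnj (\<sigma> 0) * w) = (1 - cnj (\<sigma> \<zeta>) * w) * (1 - cnj \<zeta> * \<phi> 0)"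
proof -
  have "d \<noteq> 0"
    using denominator_nonzero[of 0] by simp
  have "d * ((1 - cnj \<zeta> * \<phi> w) * (1 - cnj (\<sigma> 0) * w)) = (c * w + d) * (1 - cnj \<zeta> * \<phi> w)"
    using Krein_identity[of 0 w] assms(2) by (simp add: mult.left_commute)
  also have "\<dots> = (1 - cnj (\<sigma> \<zeta>) * w) * (d - b * cnj \<zeta>)"
    by (simp add: Krein_identity[OF assms])
  also have "d - b * cnj \<zeta> = d * (1 - cnj \<zeta> * \<phi> 0)"
    using Krein_identity[OF assms(1), of 0] by simp
  finally show ?thesis
    using \<open>d \<noteq> 0\<close> by (simp add: mult.left_commute)
qed

lemma log_kernel_phi:
  assumes "cmod \<zeta> < 1" "cmod w < 1"
  shows "log_kernel \<zeta> (\<phi> w) = log_kernel (\<sigma> \<zeta>) w - log_kernel (\<sigma> 0) w + log_kernel \<zeta> (\<phi> 0)"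
proof -
  have Re_pos: "0 < Re (1 - cnj s * z)" if "cmod s < 1" "cmod z < 1" for s z
    using that by (intro Re_one_minus_pos cmod_mult_less_1) auto
  have "Ln ((1 - cnj \<zeta> * \<phi> w) * (1 - cnj (\<sigma> 0) * w))
      = Ln (1 - cnj \<zeta> * \<phi> w) + Ln (1 - cnj (\<sigma> 0) * w)"
    using assms by (intro Ln_mult_right_half_plane Re_pos cmod_phi_less_1 cmod_sigma_less_1) auto
  moreover have "Ln ((1 - cnj (\<sigma> \<zeta>) * w) * (1 - cnj \<zeta> * \<phi> 0))
      = Ln (1 - cnj (\<sigma> \<zeta>) * w) + Ln (1 - cnj \<zeta> * \<phi> 0)"
    using assms by (intro Ln_mult_right_half_plane Re_pos cmod_phi_less_1 cmod_sigma_less_1) auto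
  ultimately have "Ln (1 - cnj \<zeta> * \<phi> w) + Ln (1 - cnj (\<sigma> 0) * w)
      = Ln (1 - cnj (\<sigma> \<zeta>) * w) + Ln (1 - cnj \<zeta> * \<phi> 0)"
    using Krein_identity_normalized[of \<zeta> w] assms by simp
  then show ?thesis
    by (simp add: log_kernel_def algebra_simps)
qed

lemma Tz_Dop_phi_kernel:
  assumes "cmod \<zeta> < 1" "cmod w < 1"
  shows "Tz (Dop \<phi> (St2_kernel \<zeta>)) w = cnj \<zeta> *
    (St2_deriv_kernel (\<sigma> \<zeta>) w - St2_deriv_kernel (\<sigma> 0) w
      + log_kernel \<zeta> (\<phi> 0) * St2_deriv_kernel 0 w)"
proof -
  have "cmod (cnj \<zeta> * \<phi> w) < 1"
    using assms by (intro cmod_mult_less_1 cmod_phi_less_1) auto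
  then have "Tz (Dop \<phi> (St2_kernel \<zeta>)) w = cnj \<zeta> * (w * log_kernel \<zeta> (\<phi> w))"
    by (simp add: Tz_def Dop_def deriv_St2_kernel)
  then show ?thesis
    unfolding log_kernel_phi[OF assms] St2_deriv_kernel_0
    by (simp add: St2_deriv_kernel_def Tz_def algebra_simps)
qed

definition adjoint_correction :: "(complex \<Rightarrow> complex) \<Rightarrow> complex \<Rightarrow> complex" where
  "adjoint_correction f z =
     deriv f 0 * St2_deriv_kernel (\<phi> 0) z - deriv f (\<sigma> 0) * St2_deriv_kernel 0 z"

lemma finite_rank_adjoint_correction: "finite_rank_op adjoint_correction"
proof -
  have "finite_rank_op (\<lambda>f z. (- 1) * (deriv f (\<sigma> 0) * St2_deriv_kernel 0 z)
      + deriv f 0 * St2_deriv_kernel (\<phi> 0) z)"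
    by (intro finite_rank_op_linear_combination finite_rank_op_rank_one bounded_functional_deriv
        St2_deriv_kernel_in_St2 cmod_sigma_less_1 cmod_phi_less_1) auto
  then show ?thesis
    by (simp add: adjoint_correction_def[abs_def])
qed

lemma inner_Tz_Dop_phi_kernel:
  assumes f: "f \<in> St2" and \<zeta>: "cmod \<zeta> < 1"
  shows "St2_inner f (Tz (Dop \<phi> (St2_kernel \<zeta>))) = Tz (Dop \<sigma> f) \<zeta> + adjoint_correction f \<zeta>"
proof -
  have in_disk: "cmod (\<sigma> \<zeta>) < 1" "cmod (\<sigma> 0) < 1" "cmod (\<phi> 0) < 1"
    using \<zeta> by (auto intro: cmod_sigma_less_1 cmod_phi_less_1)
  note kernels = in_disk(1,2)[THEN St2_deriv_kernel_in_St2] St2_deriv_kernel_in_St2[of 0, simplified]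
  let ?L = "log_kernel \<zeta> (\<phi> 0)"
  let ?g = "\<lambda>w. ?L * St2_deriv_kernel 0 w + St2_deriv_kernel (\<sigma> \<zeta>) w"
  let ?h = "\<lambda>w. (- 1) * St2_deriv_kernel (\<sigma> 0) w + ?g w"
  have g: "?g \<in> St2" and h: "?h \<in> St2"
    by (intro St2_linear_combination(1) kernels)+
  have "disk_eq (Tz (Dop \<phi> (St2_kernel \<zeta>))) (\<lambda>w. cnj \<zeta> * ?h w)"
    using \<zeta> by (simp add: disk_eq_def Tz_Dop_phi_kernel algebra_simps)
  from tcoeff_eq_if_disk_eq[OF this]
  have "St2_inner f (Tz (Dop \<phi> (St2_kernel \<zeta>))) = St2_inner f (\<lambda>w. cnj \<zeta> * ?h w)"
    by (simp add: St2_inner_def)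
  also have "\<dots> = \<zeta> * St2_inner f ?h"
    using St2_inner_cmult_right[OF f h, of "cnj \<zeta>"] by simp
  also have "St2_inner f ?h = - St2_inner f (St2_deriv_kernel (\<sigma> 0)) + St2_inner f ?g"
    using St2_inner_linear_right[OF kernels(2) g f, of "- 1"] by simp
  also have "St2_inner f ?g = cnj ?L * deriv f 0 + deriv f (\<sigma> \<zeta>)"
    using St2_inner_linear_right[OF kernels(3,1) f] by (simp add: St2_inner_deriv_kernel f in_disk)
  also have "St2_inner f (St2_deriv_kernel (\<sigma> 0)) = deriv f (\<sigma> 0)"
    by (rule St2_inner_deriv_kernel[OF f in_disk(2)])
  also have "cnj ?L = log_kernel (\<phi> 0) \<zeta>"
    using \<zeta> in_disk(3) by (intro cnj_log_kernel cmod_mult_less_1) auto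
  finally show ?thesis
    unfolding adjoint_correction_def St2_deriv_kernel_0
    by (simp add: Tz_def Dop_def St2_deriv_kernel_def algebra_simps)
qed

lemma adjoint_Tz_Dop_phi:
  assumes "is_adjoint (Dop \<phi>) Dop_adj" "is_adjoint Tz Tz_adj" "f \<in> St2"
  shows "disk_eq (Dop_adj (Tz_adj f)) (\<lambda>z. Tz (Dop \<sigma> f) z + adjoint_correction f z)"
  unfolding disk_eq_def
proof
  fix \<zeta> :: complex assume "\<zeta> \<in> ball 0 1"
  then have \<zeta>: "cmod \<zeta> < 1" by simp
  have "is_adjoint (\<lambda>f. Tz (Dop \<phi> f)) (\<lambda>f. Dop_adj (Tz_adj f))"
    by (rule is_adjoint_compose[OF assms(2,1) bounded_op_Dop_phi])
  moreover have "Tz (Dop \<phi> (St2_kernel \<zeta>)) \<in> St2"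
    by (intro bounded_op_in_St2[OF bounded_op_Tz] bounded_op_in_St2[OF bounded_op_Dop_phi]
        St2_kernel_in_St2 \<zeta>)
  ultimately have "Dop_adj (Tz_adj f) \<zeta> = St2_inner f (Tz (Dop \<phi> (St2_kernel \<zeta>)))"
    using assms(3) \<zeta> by (rule adjoint_eq_inner_kernel)
  then show "Dop_adj (Tz_adj f) \<zeta> = Tz (Dop \<sigma> f) \<zeta> + adjoint_correction f \<zeta>"
    by (simp add: inner_Tz_Dop_phi_kernel assms(3) \<zeta>)
qed

end

lemma moebius_into_diskI:
  fixes a b c d :: complex
  assumes nondeg: "a * d - b * c \<noteq> 0"
    and nopole: "\<And>z. cmod z < 1 \<Longrightarrow> c * z + d \<noteq> 0"
    and bound: "\<And>z. cmod z < 1 \<Longrightarrow> cmod ((a * z + b) / (c * z + d)) \<le> q" and "q < 1"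
  shows "moebius_into_disk a b c d"
proof
  have "closure (ball 0 1) \<subseteq> {z. cmod (a * z + b) \<le> q * cmod (c * z + d)}"
  proof (rule closure_minimal)
    show "ball 0 1 \<subseteq> {z. cmod (a * z + b) \<le> q * cmod (c * z + d)}"
      using bound nopole by (fastforce simp: norm_divide divide_le_eq)
    show "closed {z. cmod (a * z + b) \<le> q * cmod (c * z + d)}"
      by (intro closed_Collect_le continuous_intros)
  qed
  then have numerator_le: "cmod (a * z + b) \<le> q * cmod (c * z + d)" if "cmod z \<le> 1" for z
    using that by auto
  show nonzero: "c * z + d \<noteq> 0" if "cmod z \<le> 1" for z
  proof
    assume z: "c * z + d = 0"
    then have "a * z + b = 0"
      using numerator_le[OF that] by simp
    moreover have "a * d - b * c = a * (c * z + d) - c * (a * z + b)"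
      by (simp add: algebra_simps)
    ultimately show False
      using nondeg z by simp
  qed
  show "cmod ((a * z + b) / (c * z + d)) < 1" if "cmod z \<le> 1" for z
  proof -
    note numerator_le[OF that]
    also have "q * cmod (c * z + d) < cmod (c * z + d)"
      using nonzero[OF that] \<open>q < 1\<close> by simp
    finally show ?thesis
      using nonzero[OF that] by (simp add: norm_divide divide_less_eq)
  qed
qed

theorem theorem6p5:
  fixes a b c d :: complex
  defines "\<phi> \<equiv> (\<lambda>z. (a * z + b) / (c * z + d))"
      and "\<sigma> \<equiv> (\<lambda>z. (cnj a * z - cnj c) / (- cnj b * z + cnj d))"
  assumes nondeg: "a * d - b * c \<noteq> 0"
      and nopole: "\<forall>z\<in>ball 0 1. c * z + d \<noteq> 0"
      and self_map: "\<forall>z\<in>ball 0 1. \<phi> z \<in> ball 0 1"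
      and sup_lt1: "(SUP z\<in>ball 0 1. cmod (\<phi> z)) < 1"
  shows "\<exists>K1 Dphi_adj Tz_adj.
           is_adjoint (Dop \<phi>) Dphi_adj \<and> is_adjoint Tz Tz_adj \<and> finite_rank_op K1 \<and>
           (\<forall>f\<in>St2. disk_eq (Dphi_adj (Tz_adj f)) (\<lambda>z. Tz (Dop \<sigma> f) z + K1 f z))"
proof -
  have "bdd_above ((\<lambda>z. cmod (\<phi> z)) ` ball 0 1)"
    using self_map by (intro bdd_aboveI2[of _ _ 1]) (auto intro: less_imp_le)
  then have "cmod (\<phi> z) \<le> (SUP z\<in>ball 0 1. cmod (\<phi> z))" if "cmod z < 1" for z
    using that by (intro cSUP_upper) auto
  then interpret moebius: moebius_into_disk a b c d
    using nondeg nopole sup_lt1 unfolding \<phi>_def by (intro moebius_into_diskI) auto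
  have symbols: "moebius.\<phi> = \<phi>" "moebius.\<sigma> = \<sigma>"
    by (simp_all add: fun_eq_iff moebius.\<phi>_def moebius.\<sigma>_def \<phi>_def \<sigma>_def)
  obtain Dphi_adj where "is_adjoint (Dop \<phi>) Dphi_adj"
    using bounded_op_imp_is_adjoint[OF moebius.bounded_op_Dop_phi] symbols by metis
  moreover obtain Tz_adj where "is_adjoint Tz Tz_adj"
    using bounded_op_imp_is_adjoint[OF bounded_op_Tz] by blast
  ultimately show ?thesis
    using moebius.finite_rank_adjoint_correction moebius.adjoint_Tz_Dop_phi unfolding symbols by blast
qed

end
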